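(* Let $k\ge1$ and let $X$ be a finite $k$-dimensional simplicial complex. Then $\lambda(X) \leq h'(X)$.
   Context: A (finite abstract) simplicial complex $X$ on a finite vertex set $V$ is a family of subsets of $V$ closed under taking subsets; $X_i$ denotes its set of $i$-faces (faces with $i+1$ elements). Fix a linear order on $V$; an $i$-face $\tau=\{v_0<\dots<v_i\}$ has incidence numbers $[\tau:\sigma]=(-1)^j$ if $\sigma=\tau\setminus\{v_j\}$ and $0$ if $\sigma\not\subseteq\tau$. Real cochains $C^i$ are functions $X_i\to\mathbb{R}$ with inner product $\langle f,g\rangle=\sum_{\tau\in X_i} f(\tau)g(\tau)$; the real coboundary is $\delta_i f(\tau)=\sum_{\sigma\in X_i}[\tau:\sigma]f(\sigma)$; $\partial_{i+1}$ is its adjoint; $B^{k-1}=\operatorname{im}\delta_{k-2}$; $L^{\mathrm{up}}_{k-1}(X)=\partial_k\delta_{k-1}$. The spectral gap $\lambda(X)$ is the smallest eigenvalue of $L^{\mathrm{up}}_{k-1}(X)$ restricted to $(B^{k-1})^\perp$ (independent of the chosen order). The completion is $K(X):=X\cup\{\tau\subseteq V:|\tau|=k+1,\ \tau\setminus\{v\}\in X\ \forall v\in\tau\}$, which has the same faces of dimension $\le k-1$ as $X$. For a $\mathbb{Z}_2$-cochain $f:X_{k-1}\to\mathbb{Z}_2$, its $\mathbb{Z}_2$-coboundary in $X$ is $\delta_X f(\tau)=\sum_{\sigma\in X_{k-1},\sigma\subset\tau}f(\sigma)\in\mathbb{Z}_2$ for $\tau\in X_k$, and analogously $\delta_{K(X)}f$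 on the $k$-faces of $K(X)$; $|\cdot|$ denotes the Hamming weight (number of nonzero entries). For disjoint $A_0,\dots,A_{k-1}\subseteq V$, $F(A_0,\dots,A_{k-1})$ is the set of $(k-1)$-faces of $X$ with exactly one vertex in each $A_i$. Define \[h'(X):=\min_{\substack{V=\sqcup_{i=0}^{k-1}A_i,\ f\in C^{k-1}(X;\mathbb{Z}_2),\\ \operatorname{supp}(f)\subseteq F(A_0,\dots,A_{k-1})}}\frac{|V|\cdot|\delta_X f|}{|\delta_{K(X)}f|},\] where a quotient with $|\delta_{K(X)}f|=0$ is defined to be $\infty$. *)

theory Defs
  imports "HOL-Analysis.Analysis" "HOL-Library.Z2"
begin

definition abstract_simplicial_complex :: "'a set \<Rightarrow> 'a set set \<Rightarrow> bool" where
  "abstract_simplicial_complex V X \<longleftrightarrow>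
     finite V \<and> X \<subseteq> Pow V \<and> (\<forall>\<tau>\<in>X. \<forall>\<sigma>. \<sigma> \<subseteq> \<tau> \<longrightarrow> \<sigma> \<in> X)"

text \<open>Dimensions are integers: the empty face has dimension \<open>-1\<close>.\<close>

definition faces :: "'a set set \<Rightarrow> int \<Rightarrow> 'a set set" where
  "faces X i = {\<sigma> \<in> X. int (card \<sigma>) = i + 1}"

definition has_dimension :: "'a set set \<Rightarrow> int \<Rightarrow> bool" where
  "has_dimension X k \<longleftrightarrow> faces X k \<noteq> {} \<and> (\<forall>\<sigma>\<in>X. int (card \<sigma>) - 1 \<le> k)"

text \<open>Functions on the \<open>i\<close>-faces are represented by their extension by \<open>0\<close> to all sets.\<close>

definition cochains :: "'a set set \<Rightarrow> int \<Rightarrow> ('a set \<Rightarrow> 'b::zero) set" where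
  "cochains X i = {f. \<forall>\<sigma>. \<sigma> \<notin> faces X i \<longrightarrow> f \<sigma> = 0}"


subsection \<open>Real cochains and the spectral gap\<close>

text \<open>The removed vertex \<open>v\<close> is the \<open>j\<close>-th smallest of \<open>\<tau>\<close> (counting from \<open>0\<close>), where \<open>j\<close> is the
  number of vertices of \<open>\<tau>\<close> below \<open>v\<close>.\<close>

definition incidence :: "'a::linorder set \<Rightarrow> 'a set \<Rightarrow> real" where
  "incidence \<tau> \<sigma> =
     (if \<exists>v\<in>\<tau>. \<sigma> = \<tau> - {v}
      then (-1) ^ card {u \<in> \<tau>. u < (THE v. v \<in> \<tau> \<and> \<sigma> = \<tau> - {v})}
      else 0)"

definition cochain_inner ::
    "'a set set \<Rightarrow> int \<Rightarrow> ('a set \<Rightarrow> real) \<Rightarrow> ('a set \<Rightarrow> real) \<Rightarrow> real" where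
  "cochain_inner X i f g = (\<Sum>\<tau>\<in>faces X i. f \<tau> * g \<tau>)"

definition coboundary ::
    "'a::linorder set set \<Rightarrow> int \<Rightarrow> ('a set \<Rightarrow> real) \<Rightarrow> 'a set \<Rightarrow> real" where
  "coboundary X i f =
     (\<lambda>\<tau>. if \<tau> \<in> faces X (i + 1) then \<Sum>\<sigma>\<in>faces X i. incidence \<tau> \<sigma> * f \<sigma> else 0)"

text \<open>\<open>boundary X j\<close> maps \<open>j\<close>-cochains to \<open>(j - 1)\<close>-cochains and is the adjoint of
  \<open>coboundary X (j - 1)\<close>.\<close>

definition boundary ::
    "'a::linorder set set \<Rightarrow> int \<Rightarrow> ('a set \<Rightarrow> real) \<Rightarrow> 'a set \<Rightarrow> real" where
  "boundary X j g =
     (THE h. h \<in> cochains X (j - 1) \<and>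
        (\<forall>f\<in>cochains X (j - 1).
           cochain_inner X (j - 1) f h = cochain_inner X j (coboundary X (j - 1) f) g))"

definition coboundaries :: "'a::linorder set set \<Rightarrow> int \<Rightarrow> ('a set \<Rightarrow> real) set" where
  "coboundaries X i = coboundary X (i - 1) ` cochains X (i - 1)"

definition coboundaries_perp :: "'a::linorder set set \<Rightarrow> int \<Rightarrow> ('a set \<Rightarrow> real) set" where
  "coboundaries_perp X i =
     {f \<in> cochains X i. \<forall>b\<in>coboundaries X i. cochain_inner X i f b = 0}"

definition up_laplacian ::
    "'a::linorder set set \<Rightarrow> int \<Rightarrow> ('a set \<Rightarrow> real) \<Rightarrow> 'a set \<Rightarrow> real" where
  "up_laplacian X i f = boundary X (i + 1) (coboundary X i f)"

definition perp_eigenvalue :: "'a::linorder set set \<Rightarrow> int \<Rightarrow> real \<Rightarrow> bool" where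
  "perp_eigenvalue X i c \<longleftrightarrow>
     (\<exists>f\<in>coboundaries_perp X i. f \<noteq> (\<lambda>_. 0) \<and> up_laplacian X i f = (\<lambda>\<sigma>. c * f \<sigma>))"

definition spectral_gap :: "'a::linorder set set \<Rightarrow> nat \<Rightarrow> real" where
  "spectral_gap X k = (LEAST c. perp_eigenvalue X (int k - 1) c)"


subsection \<open>The Cheeger-type constant\<close>

definition completion :: "'a set \<Rightarrow> nat \<Rightarrow> 'a set set \<Rightarrow> 'a set set" where
  "completion V k X = X \<union> {\<tau>. \<tau> \<subseteq> V \<and> card \<tau> = k + 1 \<and> (\<forall>v\<in>\<tau>. \<tau> - {v} \<in> X)}"

definition coboundary2 :: "'a set set \<Rightarrow> int \<Rightarrow> ('a set \<Rightarrow> bit) \<Rightarrow> 'a set \<Rightarrow> bit" where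
  "coboundary2 X i f =
     (\<lambda>\<tau>. if \<tau> \<in> faces X (i + 1) then \<Sum>\<sigma> | \<sigma> \<in> faces X i \<and> \<sigma> \<subset> \<tau>. f \<sigma> else 0)"

definition support :: "('b \<Rightarrow> bit) \<Rightarrow> 'b set" where
  "support f = {x. f x \<noteq> 0}"

definition hamming_weight :: "('b \<Rightarrow> bit) \<Rightarrow> nat" where
  "hamming_weight f = card (support f)"

definition is_partition :: "'a set \<Rightarrow> nat \<Rightarrow> (nat \<Rightarrow> 'a set) \<Rightarrow> bool" where
  "is_partition V k A \<longleftrightarrow> disjoint_family_on A {..<k} \<and> (\<Union>i<k. A i) = V"

definition transversal_faces :: "'a set set \<Rightarrow> nat \<Rightarrow> (nat \<Rightarrow> 'a set) \<Rightarrow> 'a set set" where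
  "transversal_faces X k A = {\<sigma> \<in> faces X (int k - 1). \<forall>i<k. card (\<sigma> \<inter> A i) = 1}"

definition cheeger_quotient ::
    "'a set \<Rightarrow> nat \<Rightarrow> 'a set set \<Rightarrow> ('a set \<Rightarrow> bit) \<Rightarrow> ereal" where
  "cheeger_quotient V k X f =
     (let d = hamming_weight (coboundary2 X (int k - 1) f);
          d' = hamming_weight (coboundary2 (completion V k X) (int k - 1) f)
      in if d' = 0 then \<infinity> else ereal (real (card V) * real d / real d'))"

definition cheeger_test_cochains ::
    "'a set \<Rightarrow> nat \<Rightarrow> 'a set set \<Rightarrow> ('a set \<Rightarrow> bit) set" where
  "cheeger_test_cochains V k X =
     {f \<in> cochains X (int k - 1).
        \<exists>A. is_partition V k A \<and> support f \<subseteq> transversal_faces X k A}"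

definition cheeger' :: "'a set \<Rightarrow> nat \<Rightarrow> 'a set set \<Rightarrow> ereal" where
  "cheeger' V k X = Min (cheeger_quotient V k X ` cheeger_test_cochains V k X)"


subsection \<open>Well-definedness\<close>

lemma finite_faces: "abstract_simplicial_complex V X \<Longrightarrow> finite (faces X i)"
  unfolding abstract_simplicial_complex_def faces_def
  by (metis (no_types, lifting) finite_Pow_iff finite_subset mem_Collect_eq subsetI)

lemma incidence_remove:
  assumes "v \<in> \<tau>"
  shows "incidence \<tau> (\<tau> - {v}) = (-1) ^ card {u \<in> \<tau>. u < v}"
proof -
  have "(THE w. w \<in> \<tau> \<and> \<tau> - {v} = \<tau> - {w}) = v"
    using assms by (intro the_equality) auto
  then show ?thesis
    using assms by (auto simp: incidence_def)
qed

lemma boundary_eq: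
  assumes "abstract_simplicial_complex V X"
  shows "boundary X j g =
    (\<lambda>\<sigma>. if \<sigma> \<in> faces X (j - 1) then \<Sum>\<tau>\<in>faces X j. incidence \<tau> \<sigma> * g \<tau> else 0)"
    (is "_ = ?h")
  unfolding boundary_def
proof (rule the_equality, intro conjI ballI)
  show "?h \<in> cochains X (j - 1)"
    by (simp add: cochains_def)
next
  fix f :: "'a set \<Rightarrow> real"
  have "cochain_inner X (j - 1) f ?h =
      (\<Sum>\<sigma>\<in>faces X (j - 1). \<Sum>\<tau>\<in>faces X j. f \<sigma> * (incidence \<tau> \<sigma> * g \<tau>))"
    by (simp add: cochain_inner_def sum_distrib_left)
  also have "\<dots> = (\<Sum>\<tau>\<in>faces X j. \<Sum>\<sigma>\<in>faces X (j - 1). f \<sigma> * (incidence \<tau> \<sigma> * g \<tau>))"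
    by (rule sum.swap)
  also have "\<dots> = cochain_inner X j (coboundary X (j - 1) f) g"
    by (simp add: cochain_inner_def coboundary_def sum_distrib_left mult_ac)
  finally show "cochain_inner X (j - 1) f ?h = cochain_inner X j (coboundary X (j - 1) f) g" .
next
  fix h :: "'a set \<Rightarrow> real"
  assume h: "h \<in> cochains X (j - 1) \<and>
    (\<forall>f\<in>cochains X (j - 1).
       cochain_inner X (j - 1) f h = cochain_inner X j (coboundary X (j - 1) f) g)"
  show "h = ?h"
  proof
    fix \<sigma>
    show "h \<sigma> = ?h \<sigma>"
    proof (cases "\<sigma> \<in> faces X (j - 1)")
      case False
      then show ?thesis using h by (auto simp: cochains_def)
    next
      case True
      define e :: "'a set \<Rightarrow> real" where "e = (\<lambda>\<rho>. if \<rho> = \<sigma> then 1 else 0)"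
      have fin: "finite (faces X (j - 1))"
        using assms by (rule finite_faces)
      have "e \<in> cochains X (j - 1)"
        using True by (auto simp: e_def cochains_def)
      then have "cochain_inner X (j - 1) e h = cochain_inner X j (coboundary X (j - 1) e) g"
        using h by blast
      moreover have "cochain_inner X (j - 1) e h = h \<sigma>"
        using True fin by (simp add: cochain_inner_def e_def if_distrib[of "\<lambda>x. x * _"] cong: if_cong)
      moreover have "coboundary X (j - 1) e \<tau> = incidence \<tau> \<sigma>" if "\<tau> \<in> faces X j" for \<tau>
        using that True fin by (simp add: coboundary_def e_def if_distrib[of "\<lambda>x. _ * x"] cong: if_cong)
      ultimately show ?thesis
        using True by (simp add: cochain_inner_def)
    qed
  qed
qed

lemma finite_cheeger_test_cochains:
  assumes "abstract_simplicial_complex V X"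
  shows "finite (cheeger_test_cochains V k X)"
proof -
  have "finite (UNIV :: bit set)"
    by (rule finite_subset[of _ "{0, 1}"]) (auto intro: bit_not_zero_iff[THEN iffD1])
  then have "finite {f :: 'a set \<Rightarrow> bit.
      \<forall>x. (x \<in> faces X (int k - 1) \<longrightarrow> f x \<in> UNIV) \<and> (x \<notin> faces X (int k - 1) \<longrightarrow> f x = 0)}"
    by (intro finite_set_of_finite_funs finite_faces[OF assms])
  then show ?thesis
    by (rule rev_finite_subset) (auto simp: cheeger_test_cochains_def cochains_def)
qed

lemma cheeger_test_cochains_nonempty:
  assumes "k \<ge> 1"
  shows "(\<lambda>_. 0) \<in> cheeger_test_cochains V k X"
proof -
  have "is_partition V k (\<lambda>i. if i = 0 then V else {})"
    using assms by (auto simp: is_partition_def disjoint_family_on_def split: if_splits)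
  then show ?thesis
    by (auto simp: cheeger_test_cochains_def cochains_def support_def)
qed

end

theory Submission
  imports Defs
begin

text \<open>Orient every transversal face by the order of the parts \<open>A 0, \<dots>, A (k - 1)\<close>. This lifts \<open>f\<close> to a
  real cochain \<open>g\<close> whose real coboundary takes values \<open>0, 1, -1\<close> and is nonzero exactly where the
  \<open>\<int>\<^sub>2\<close>-coboundary of \<open>f\<close> is, both in \<open>X\<close> and in its completion \<open>K\<close>. Replace \<open>g\<close> by the
  cochain \<open>h\<close> of least norm with the same coboundary in \<open>K\<close>; it is orthogonal to the coboundaries.
  Comparing \<open>K\<close> with the full simplex on \<open>V\<close>, whose up- and down-Laplacians add up to \<open>card V\<close>
  times the identity, gives \<open>|\<delta>\<^sub>K h|\<^sup>2 \<le> card V * |h|\<^sup>2\<close>, while the Rayleigh characterisation of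
  the spectral gap gives \<open>\<lambda> * |h|\<^sup>2 \<le> |\<delta>\<^sub>X h|\<^sup>2\<close>.\<close>

subsection \<open>Signs and the full coboundary\<close>

text \<open>For \<open>v\<close> in \<open>\<sigma>\<close> this is the incidence number of the
  facet opposite \<open>v\<close>. It also makes sense for \<open>v\<close> outside
  \<open>\<sigma>\<close>, which the contractions and the insertion formulas rely on.\<close>

definition vsign :: "'a::linorder \<Rightarrow> 'a set \<Rightarrow> real" where
  "vsign v \<sigma> = (-1) ^ card {u \<in> \<sigma>. u < v}"

text \<open>This is the coboundary of the full simplex. It mentions no complex, so the coboundaries
  in \<open>X\<close> and in its completion can both be read off from it.\<close>

definition full_coboundary :: "('a::linorder set \<Rightarrow> real) \<Rightarrow> 'a set \<Rightarrow> real" where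
  "full_coboundary f \<tau> = (\<Sum>v\<in>\<tau>. vsign v \<tau> * f (\<tau> - {v}))"

lemma vsign_square [simp]: "vsign v \<sigma> * vsign v \<sigma> = 1"
  by (simp add: vsign_def flip: power_mult_distrib)

lemma vsign_mult_square: "(vsign v \<sigma> * x) * (vsign v \<sigma> * x) = x\<^sup>2"
  by (metis mult.commute mult.left_commute mult_1 power2_eq_square vsign_square)

lemma vsign_insert:
  assumes "finite \<sigma>" "w \<notin> \<sigma>"
  shows "vsign v (insert w \<sigma>) = (if w < v then - vsign v \<sigma> else vsign v \<sigma>)"
proof (cases "w < v")
  case True
  then have "{u \<in> insert w \<sigma>. u < v} = insert w {u \<in> \<sigma>. u < v}"
    by auto
  with True assms show ?thesis
    by (simp add: vsign_def)
next
  case False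
  then have "{u \<in> insert w \<sigma>. u < v} = {u \<in> \<sigma>. u < v}"
    by auto
  with False show ?thesis
    by (simp add: vsign_def)
qed

lemma vsign_remove:
  assumes "finite \<tau>" "w \<in> \<tau>"
  shows "vsign v (\<tau> - {w}) = (if w < v then - vsign v \<tau> else vsign v \<tau>)"
  using vsign_insert[of "\<tau> - {w}" w v] assms by (auto simp: insert_absorb)

text \<open>One of \<open>v\<close> and \<open>w\<close> lies below the other, so the two insertions
  flip exactly one of the two signs. This drives both the Clifford relations and the comparison of
  the orientations of two facets.\<close>

lemma vsign_insert_mult:
  assumes "finite \<sigma>" "v \<notin> \<sigma>" "w \<notin> \<sigma>" "v \<noteq> w"
  shows "vsign v (insert v (insert w \<sigma>)) * vsign w (insert v (insert w \<sigma>))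
    = - (vsign v \<sigma> * vsign w \<sigma>)"
  using assms by (auto simp: vsign_insert)

lemma full_coboundary_twice:
  assumes "finite \<tau>"
  shows "full_coboundary (full_coboundary f) \<tau> = 0"
proof -
  define P where "P = (SIGMA v:\<tau>. \<tau> - {v})"
  define F where "F = (\<lambda>(v, w). vsign v \<tau> * (vsign w (\<tau> - {v}) * f (\<tau> - {v} - {w})))"
  have "full_coboundary (full_coboundary f) \<tau> = sum F P"
    using assms by (simp add: full_coboundary_def P_def F_def sum.Sigma sum_distrib_left)
  \<comment> \<open>Exchanging the order in which two vertices are removed leaves the remaining set
    unchanged but flips the sign, so the sum equals its own negative.\<close>
  moreover have "sum F P = (\<Sum>p\<in>P. F (prod.swap p))"
    by (rule sum.reindex_bij_witness[of _ prod.swap prod.swap]) (auto simp: P_def)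
  moreover have "F (prod.swap p) = - F p" if p: "p \<in> P" for p
  proof -
    obtain v w where p': "p = (v, w)" by force
    with p have "v \<in> \<tau>" "w \<in> \<tau>" "v \<noteq> w"
      by (auto simp: P_def)
    moreover have "f (\<tau> - {v} - {w}) = f (\<tau> - {w} - {v})"
      by (metis Diff_insert Diff_insert2)
    ultimately show ?thesis
      using assms by (cases v w rule: linorder_cases) (simp_all add: F_def p' vsign_remove)
  qed
  then have "(\<Sum>p\<in>P. F (prod.swap p)) = - sum F P"
    by (simp add: sum_negf)
  ultimately show ?thesis by linarith
qed

text \<open>The full coboundary is a sum of one wedge operator \<open>E v\<close> per vertex, and its adjoint
  is the sum of the contractions \<open>I v\<close>. The Clifford relations
  \<open>E v\<^sup>* E w + I v\<^sup>* I w = \<delta>\<^bsub>vw\<^esub>\<close> show that the two squared norms add up to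
  \<open>card V\<close> times the squared norm of \<open>h\<close>.\<close>

lemma full_coboundary_norm_le:
  fixes h :: "'a::linorder set \<Rightarrow> real"
  assumes V: "finite V"
  shows "(\<Sum>\<tau>\<in>Pow V. (full_coboundary h \<tau>)\<^sup>2) \<le> card V * (\<Sum>\<sigma>\<in>Pow V. (h \<sigma>)\<^sup>2)"
proof -
  define E where "E = (\<lambda>v \<tau>. if v \<in> \<tau> then vsign v \<tau> * h (\<tau> - {v}) else 0)"
  define I where "I = (\<lambda>v \<tau>. if v \<in> \<tau> then 0 else vsign v \<tau> * h (insert v \<tau>))"
  define N where "N = (\<Sum>\<sigma>\<in>Pow V. (h \<sigma>)\<^sup>2)"
  have fin: "finite \<tau>" if "\<tau> \<in> Pow V" for \<tau>
    using that V finite_subset by auto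
  have square: "(\<Sum>v\<in>V. F v)\<^sup>2 = (\<Sum>v\<in>V. \<Sum>w\<in>V. F v * F w)" for F :: "'a \<Rightarrow> real"
    by (simp add: power2_eq_square sum_product)
  have D: "full_coboundary h \<tau> = (\<Sum>v\<in>V. E v \<tau>)" if "\<tau> \<in> Pow V" for \<tau>
    unfolding full_coboundary_def
    by (rule sum.mono_neutral_cong_left) (use V that in \<open>auto simp: E_def\<close>)
  have diag: "(\<Sum>\<tau>\<in>Pow V. E v \<tau> * E v \<tau>) + (\<Sum>\<tau>\<in>Pow V. I v \<tau> * I v \<tau>) = N"
    if v: "v \<in> V" for v
  proof -
    have "(\<Sum>\<tau>\<in>Pow V. E v \<tau> * E v \<tau>) = (\<Sum>\<tau>\<in>{\<tau>\<in>Pow V. v \<in> \<tau>}. (h (\<tau> - {v}))\<^sup>2)"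
      by (rule sum.mono_neutral_cong_right)
        (use V in \<open>auto simp: E_def vsign_mult_square\<close>)
    also have "\<dots> = (\<Sum>\<sigma>\<in>{\<sigma>\<in>Pow V. v \<notin> \<sigma>}. (h \<sigma>)\<^sup>2)"
      by (rule sum.reindex_bij_witness[of _ "insert v" "\<lambda>\<tau>. \<tau> - {v}"]) (use v in auto)
    finally have 1: "(\<Sum>\<tau>\<in>Pow V. E v \<tau> * E v \<tau>) = (\<Sum>\<sigma>\<in>{\<sigma>\<in>Pow V. v \<notin> \<sigma>}. (h \<sigma>)\<^sup>2)" .
    have "(\<Sum>\<tau>\<in>Pow V. I v \<tau> * I v \<tau>) = (\<Sum>\<tau>\<in>{\<tau>\<in>Pow V. v \<notin> \<tau>}. (h (insert v \<tau>))\<^sup>2)"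
      by (rule sum.mono_neutral_cong_right)
        (use V in \<open>auto simp: I_def vsign_mult_square\<close>)
    also have "\<dots> = (\<Sum>\<sigma>\<in>{\<sigma>\<in>Pow V. v \<in> \<sigma>}. (h \<sigma>)\<^sup>2)"
      by (rule sum.reindex_bij_witness[of _ "\<lambda>\<tau>. \<tau> - {v}" "insert v"]) (use v in auto)
    finally have 2: "(\<Sum>\<tau>\<in>Pow V. I v \<tau> * I v \<tau>) = (\<Sum>\<sigma>\<in>{\<sigma>\<in>Pow V. v \<in> \<sigma>}. (h \<sigma>)\<^sup>2)" .
    have "N = (\<Sum>\<sigma>\<in>{\<sigma>\<in>Pow V. v \<notin> \<sigma>} \<union> {\<sigma>\<in>Pow V. v \<in> \<sigma>}. (h \<sigma>)\<^sup>2)"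
      unfolding N_def by (rule sum.cong) auto
    also have "\<dots> = (\<Sum>\<sigma>\<in>{\<sigma>\<in>Pow V. v \<notin> \<sigma>}. (h \<sigma>)\<^sup>2) + (\<Sum>\<sigma>\<in>{\<sigma>\<in>Pow V. v \<in> \<sigma>}. (h \<sigma>)\<^sup>2)"
      by (rule sum.union_disjoint) (use V in auto)
    finally show ?thesis using 1 2 by simp
  qed
  have off: "(\<Sum>\<tau>\<in>Pow V. E v \<tau> * E w \<tau>) + (\<Sum>\<tau>\<in>Pow V. I v \<tau> * I w \<tau>) = 0"
    if vw: "v \<in> V" "w \<in> V" "v \<noteq> w" for v w
  proof -
    have "(\<Sum>\<tau>\<in>Pow V. E v \<tau> * E w \<tau>) = (\<Sum>\<tau>\<in>{\<tau>\<in>Pow V. v \<in> \<tau> \<and> w \<in> \<tau>}. E v \<tau> * E w \<tau>)"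
      by (rule sum.mono_neutral_right) (use V in \<open>auto simp: E_def\<close>)
    \<comment> \<open>Deleting both vertices matches wedge terms with contraction terms:
      \<open>E v\<close> at \<open>\<tau>\<close> reads the value of \<open>h\<close> that
      \<open>I w\<close> reads at \<open>\<rho>\<close>, and the product of signs changes
      sign.\<close>
    also have "\<dots> = (\<Sum>\<rho>\<in>{\<rho>\<in>Pow V. v \<notin> \<rho> \<and> w \<notin> \<rho>}. - (I v \<rho> * I w \<rho>))"
    proof (rule sum.reindex_bij_witness[of _ "\<lambda>\<rho>. insert v (insert w \<rho>)" "\<lambda>\<tau>. \<tau> - {v, w}"])
      fix \<tau> assume "\<tau> \<in> {\<tau> \<in> Pow V. v \<in> \<tau> \<and> w \<in> \<tau>}"
      then have \<tau>: "\<tau> \<in> Pow V" "v \<in> \<tau>" "w \<in> \<tau>" by auto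
      define \<rho> where "\<rho> = \<tau> - {v, w}"
      have \<rho>: "finite \<rho>" "v \<notin> \<rho>" "w \<notin> \<rho>" and \<tau>_eq: "\<tau> = insert v (insert w \<rho>)"
        using fin[OF \<tau>(1)] \<tau> by (auto simp: \<rho>_def)
      have "vsign v \<tau> * vsign w \<tau> = - (vsign v \<rho> * vsign w \<rho>)"
        unfolding \<tau>_eq using \<rho> vw by (intro vsign_insert_mult)
      then have "- (I v \<rho> * I w \<rho>) = (vsign v \<tau> * vsign w \<tau>) * (h (insert w \<rho>) * h (insert v \<rho>))"
        using \<rho> by (simp add: I_def mult_ac)
      moreover have "insert w \<rho> = \<tau> - {v}" "insert v \<rho> = \<tau> - {w}"
        using \<rho> vw by (auto simp: \<tau>_eq)
      ultimately show "- (I v (\<tau> - {v, w}) * I w (\<tau> - {v, w})) = E v \<tau> * E w \<tau>"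
        unfolding \<rho>_def[symmetric] using \<tau> by (simp add: E_def mult_ac)
    qed (use vw in auto)
    also have "\<dots> = - (\<Sum>\<rho>\<in>Pow V. I v \<rho> * I w \<rho>)"
      unfolding sum_negf
      by (rule arg_cong[where f = uminus], rule sum.mono_neutral_left)
        (use V in \<open>auto simp: I_def\<close>)
    finally show ?thesis by simp
  qed
  have "(\<Sum>\<tau>\<in>Pow V. (full_coboundary h \<tau>)\<^sup>2) + (\<Sum>\<tau>\<in>Pow V. (\<Sum>v\<in>V. I v \<tau>)\<^sup>2)
      = (\<Sum>\<tau>\<in>Pow V. \<Sum>v\<in>V. \<Sum>w\<in>V. E v \<tau> * E w \<tau>) + (\<Sum>\<tau>\<in>Pow V. \<Sum>v\<in>V. \<Sum>w\<in>V. I v \<tau> * I w \<tau>)"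
    by (simp add: D square)
  also have "\<dots> = (\<Sum>v\<in>V. \<Sum>w\<in>V. (\<Sum>\<tau>\<in>Pow V. E v \<tau> * E w \<tau>) + (\<Sum>\<tau>\<in>Pow V. I v \<tau> * I w \<tau>))"
    by (simp add: sum.distrib sum.swap[of _ "Pow V"])
  also have "\<dots> = (\<Sum>v\<in>V. \<Sum>w\<in>V. if v = w then N else 0)"
    by (intro sum.cong refl) (use diag off in auto)
  also have "\<dots> = card V * N"
    using V by simp
  finally have "(\<Sum>\<tau>\<in>Pow V. (full_coboundary h \<tau>)\<^sup>2) + (\<Sum>\<tau>\<in>Pow V. (\<Sum>v\<in>V. I v \<tau>)\<^sup>2)
      = card V * N" .
  \<comment> \<open>This is the squared norm of the adjoint applied to \<open>h\<close>; dropping it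
    turns the identity into the bound.\<close>
  moreover have "(\<Sum>\<tau>\<in>Pow V. (\<Sum>v\<in>V. I v \<tau>)\<^sup>2) \<ge> 0"
    by (simp add: sum_nonneg)
  ultimately show ?thesis by (simp add: N_def)
qed

subsection \<open>The spectral gap as a minimal Rayleigh quotient\<close>

lemma face_remove:
  assumes "abstract_simplicial_complex V X" "\<tau> \<in> faces X (i + 1)" "v \<in> \<tau>"
  shows "\<tau> - {v} \<in> faces X i"
proof -
  have "\<tau> \<subseteq> V" "finite V" "\<tau> \<in> X" "\<tau> - {v} \<in> X"
    using assms by (auto simp: abstract_simplicial_complex_def faces_def)
  moreover have "finite \<tau>"
    using \<open>\<tau> \<subseteq> V\<close> \<open>finite V\<close> finite_subset by blast
  moreover have "card \<tau> > 0"
    using assms \<open>finite \<tau>\<close> by (auto simp: card_gt_0_iff)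
  ultimately show ?thesis
    using assms by (auto simp: faces_def card_Diff_singleton)
qed

text \<open>Removing different vertices gives different facets, and \<open>F\<close> vanishes on
  facets outside \<open>S\<close> and on members of \<open>S\<close> that are not facets. A general
  monoid is allowed so that real and \<open>bit\<close> coboundaries are both covered.\<close>

lemma sum_facets:
  fixes F :: "'a set \<Rightarrow> 'b::comm_monoid_add"
  assumes "finite S" "finite \<tau>" "\<And>\<sigma>. \<sigma> \<notin> S \<Longrightarrow> F \<sigma> = 0" "\<And>\<sigma>. \<forall>v\<in>\<tau>. \<sigma> \<noteq> \<tau> - {v} \<Longrightarrow> F \<sigma> = 0"
  shows "sum F S = (\<Sum>v\<in>\<tau>. F (\<tau> - {v}))"
proof -
  have "inj_on (\<lambda>v. \<tau> - {v}) \<tau>"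
    by (auto simp: inj_on_def)
  then have "(\<Sum>v\<in>\<tau>. F (\<tau> - {v})) = sum F ((\<lambda>v. \<tau> - {v}) ` \<tau>)"
    by (simp add: sum.reindex)
  also have "\<dots> = sum F (S \<union> (\<lambda>v. \<tau> - {v}) ` \<tau>)"
    by (rule sum.mono_neutral_left) (use assms in auto)
  also have "\<dots> = sum F S"
    by (rule sum.mono_neutral_right) (use assms in auto)
  finally show ?thesis ..
qed

lemma coboundary_eq_full:
  assumes "finite (faces X i)" "f \<in> cochains X i" "\<tau> \<in> faces X (i + 1)" "finite \<tau>"
  shows "coboundary X i f \<tau> = full_coboundary f \<tau>"
proof -
  have "(\<Sum>\<sigma>\<in>faces X i. incidence \<tau> \<sigma> * f \<sigma>) = (\<Sum>v\<in>\<tau>. incidence \<tau> (\<tau> - {v}) * f (\<tau> - {v}))"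
    by (rule sum_facets) (use assms in \<open>auto simp: cochains_def incidence_def\<close>)
  then show ?thesis
    using assms by (simp add: coboundary_def full_coboundary_def incidence_remove vsign_def)
qed

text \<open>Only the facets of \<open>\<tau>\<close> have to lie in \<open>X\<close>, not
  \<open>\<tau>\<close> itself. This is the situation of a top face of the completion.\<close>

lemma full_coboundary_coboundary:
  assumes X: "abstract_simplicial_complex V X" and e: "e \<in> cochains X i"
    and \<tau>: "finite \<tau>" "\<And>v. v \<in> \<tau> \<Longrightarrow> \<tau> - {v} \<in> faces X (i + 1)"
  shows "full_coboundary (coboundary X i e) \<tau> = 0"
proof -
  have "full_coboundary (coboundary X i e) \<tau> = full_coboundary (full_coboundary e) \<tau>"
    unfolding full_coboundary_def[of "coboundary X i e"]
      full_coboundary_def[of "full_coboundary e"]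
    using assms by (simp add: coboundary_eq_full finite_faces[OF X])
  with \<tau> show ?thesis by (simp add: full_coboundary_twice)
qed

lemma finite_face: "abstract_simplicial_complex V X \<Longrightarrow> \<tau> \<in> faces X i \<Longrightarrow> finite \<tau>"
  unfolding abstract_simplicial_complex_def faces_def by (auto intro: finite_subset)

lemma coboundary_cochain: "coboundary X i f \<in> cochains X (i + 1)"
  by (auto simp: coboundary_def cochains_def)

lemma coboundary_coboundary:
  assumes X: "abstract_simplicial_complex V X" and e: "e \<in> cochains X i"
  shows "coboundary X (i + 1) (coboundary X i e) = (\<lambda>_. 0)"
proof
  fix \<tau>
  show "coboundary X (i + 1) (coboundary X i e) \<tau> = 0"
  proof (cases "\<tau> \<in> faces X (i + 1 + 1)")
    case True
    then have "coboundary X (i + 1) (coboundary X i e) \<tau> = full_coboundary (coboundary X i e) \<tau>"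
      using X by (intro coboundary_eq_full) (auto simp: finite_faces coboundary_cochain finite_face)
    also have "\<dots> = 0"
      using True X e by (intro full_coboundary_coboundary) (auto simp: finite_face face_remove)
    finally show ?thesis .
  qed (simp add: coboundary_def)
qed

section \<open>The up-Laplacian and the algebra of the inner product\<close>

lemma up_laplacian_cochain:
  assumes "abstract_simplicial_complex V X"
  shows "up_laplacian X i f \<in> cochains X i"
  using assms by (simp add: up_laplacian_def boundary_eq cochains_def)

lemma cochain_inner_up_laplacian:
  assumes "abstract_simplicial_complex V X"
  shows "cochain_inner X i g (up_laplacian X i f)
    = cochain_inner X (i + 1) (coboundary X i g) (coboundary X i f)"
proof -
  have "cochain_inner X i g (up_laplacian X i f) =
      (\<Sum>\<sigma>\<in>faces X i. \<Sum>\<tau>\<in>faces X (i + 1). g \<sigma> * (incidence \<tau> \<sigma> * coboundary X i f \<tau>))"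
    using assms by (simp add: cochain_inner_def sum_distrib_left up_laplacian_def boundary_eq)
  also have "\<dots> = (\<Sum>\<tau>\<in>faces X (i + 1). \<Sum>\<sigma>\<in>faces X i. g \<sigma> * (incidence \<tau> \<sigma> * coboundary X i f \<tau>))"
    by (rule sum.swap)
  also have "\<dots> = cochain_inner X (i + 1) (coboundary X i g) (coboundary X i f)"
    unfolding cochain_inner_def
    by (rule sum.cong) (auto simp: coboundary_def[of X i g] sum_distrib_left sum_distrib_right mult_ac)
  finally show ?thesis .
qed

lemma cochain_inner_commute: "cochain_inner X i f g = cochain_inner X i g f"
  by (simp add: cochain_inner_def mult.commute)

lemma cochain_inner_zero [simp]:
  "cochain_inner X i (\<lambda>_. 0) g = 0" "cochain_inner X i g (\<lambda>_. 0) = 0"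
  by (simp_all add: cochain_inner_def)

lemma cochain_inner_add_scaled:
  "cochain_inner X i (\<lambda>\<sigma>. f \<sigma> + t * g \<sigma>) h = cochain_inner X i f h + t * cochain_inner X i g h"
  "cochain_inner X i h (\<lambda>\<sigma>. f \<sigma> + t * g \<sigma>) = cochain_inner X i h f + t * cochain_inner X i h g"
  by (simp_all add: cochain_inner_def algebra_simps sum.distrib sum_distrib_left)

lemma cochain_inner_scaled:
  "cochain_inner X i (\<lambda>\<sigma>. t * g \<sigma>) h = t * cochain_inner X i g h"
  "cochain_inner X i h (\<lambda>\<sigma>. t * g \<sigma>) = t * cochain_inner X i h g"
  by (simp_all add: cochain_inner_def algebra_simps sum_distrib_left)

lemma cochain_inner_norm_add_scaled:
  "cochain_inner X i (\<lambda>\<sigma>. f \<sigma> + t * g \<sigma>) (\<lambda>\<sigma>. f \<sigma> + t * g \<sigma>)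
    = cochain_inner X i f f + t * (2 * cochain_inner X i f g) + t\<^sup>2 * cochain_inner X i g g"
  unfolding cochain_inner_add_scaled cochain_inner_commute[of X i g f]
  by (simp add: algebra_simps power2_eq_square)

lemma coboundary_add_scaled:
  "coboundary X i (\<lambda>\<sigma>. f \<sigma> + t * g \<sigma>) = (\<lambda>\<tau>. coboundary X i f \<tau> + t * coboundary X i g \<tau>)"
  by (auto simp: coboundary_def algebra_simps sum.distrib sum_distrib_left)

lemma coboundary_scaled:
  "coboundary X i (\<lambda>\<sigma>. t * g \<sigma>) = (\<lambda>\<tau>. t * coboundary X i g \<tau>)"
  by (auto simp: coboundary_def algebra_simps sum_distrib_left)

lemma cochain_inner_nonneg [simp]: "cochain_inner X i f f \<ge> 0"
  by (simp add: cochain_inner_def sum_nonneg)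

lemma cochain_inner_eq_0D:
  assumes "finite (faces X i)" "f \<in> cochains X i" "cochain_inner X i f f = 0"
  shows "f = (\<lambda>_. 0)"
  using assms by (auto simp: cochain_inner_def sum_nonneg_eq_0_iff cochains_def)

lemma cochains_add_scaled:
  fixes f g :: "'a set \<Rightarrow> real"
  shows "f \<in> cochains X i \<Longrightarrow> g \<in> cochains X i \<Longrightarrow> (\<lambda>\<sigma>. f \<sigma> + t * g \<sigma>) \<in> cochains X i"
  by (auto simp: cochains_def)

lemma coboundaries_perp_add_scaled:
  "f \<in> coboundaries_perp X i \<Longrightarrow> g \<in> coboundaries_perp X i
    \<Longrightarrow> (\<lambda>\<sigma>. f \<sigma> + t * g \<sigma>) \<in> coboundaries_perp X i"
  by (auto simp: coboundaries_perp_def cochain_inner_add_scaled cochains_add_scaled)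

lemma coboundaries_perp_scaled:
  "g \<in> coboundaries_perp X i \<Longrightarrow> (\<lambda>\<sigma>. t * g \<sigma>) \<in> coboundaries_perp X i"
  by (auto simp: coboundaries_perp_def cochain_inner_scaled cochains_def)

text \<open>This is the first-order condition at a minimum, used for both minimisations below: of
  the Rayleigh quotient and of the norm.\<close>

lemma quadratic_nonneg_linear_coeff_0:
  fixes a b :: real
  assumes "\<And>t. 0 \<le> t * a + t\<^sup>2 * b"
  shows "a = 0"
proof (rule ccontr)
  assume a: "a \<noteq> 0"
  \<comment> \<open>Any positive \<open>B\<close> above \<open>b\<close> works: at
    \<open>t = - a / B\<close> the quadratic is \<open>a\<^sup>2 * (b - B) / B\<^sup>2\<close>,
    which is negative.\<close>
  define B where "B = \<bar>b\<bar> + 1"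
  have B: "B > 0" "b < B" by (auto simp: B_def)
  have "(- a / B) * a + (- a / B)\<^sup>2 * b = a\<^sup>2 * (b - B) / B\<^sup>2"
    using B by (simp add: field_simps power2_eq_square)
  also have "\<dots> < 0"
    using B a by (intro divide_neg_pos mult_pos_neg) auto
  finally show False using assms[of "- a / B"] by simp
qed

section \<open>Compactness in the product topology on cochains\<close>

lemma continuous_on_cochain_inner:
  assumes "continuous_on S F" "continuous_on S G"
  shows "continuous_on S (\<lambda>x. cochain_inner X i (F x) (G x))"
  unfolding cochain_inner_def
  by (intro continuous_on_sum continuous_on_mult
      assms[THEN continuous_on_product_then_coordinatewise])

lemma continuous_on_coboundary: "continuous_on S (coboundary X i)"
proof (rule continuous_on_coordinatewise_then_product)
  fix \<tau>
  have "continuous_on S (\<lambda>f :: 'a set \<Rightarrow> real. \<Sum>\<sigma>\<in>faces X i. incidence \<tau> \<sigma> * f \<sigma>)"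
    by (intro continuous_on_sum continuous_on_mult continuous_on_const
        continuous_on_product_then_coordinatewise[OF continuous_on_id])
  then show "continuous_on S (\<lambda>f. coboundary X i f \<tau>)"
    by (cases "\<tau> \<in> faces X (i + 1)") (simp_all add: coboundary_def)
qed

lemma closed_cochains: "closed (cochains X i :: ('a set \<Rightarrow> real) set)"
proof -
  have "closed {f :: 'a set \<Rightarrow> real. \<sigma> \<notin> faces X i \<longrightarrow> f \<sigma> = 0}" for \<sigma>
    by (cases "\<sigma> \<in> faces X i")
      (simp_all add: closed_Collect_eq)
  then show ?thesis
    unfolding cochains_def by (rule closed_Collect_all)
qed

text \<open>The norm bounds every coordinate on a face, and all other coordinates are
  \<open>0\<close>. So the ball is a closed subset of a product of compact intervals.\<close>

lemma compact_cochain_ball: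
  assumes "finite (faces X i)"
  shows "compact {f \<in> cochains X i. cochain_inner X i f f \<le> r}" (is "compact ?S")
proof -
  define B where "B = (PiE UNIV (\<lambda>_. {- sqrt r..sqrt r}) :: ('a set \<Rightarrow> real) set)"
  have "compactin (product_topology (\<lambda>_::'a set. euclidean :: real topology) UNIV) B"
    unfolding B_def compactin_PiE by simp
  then have "compact B"
    by (simp add: euclidean_product_topology)
  have "closed {f :: 'a set \<Rightarrow> real. cochain_inner X i f f \<le> r}"
    by (intro closed_Collect_le continuous_on_cochain_inner continuous_on_const continuous_on_id)
  then have "closed (cochains X i \<inter> {f :: 'a set \<Rightarrow> real. cochain_inner X i f f \<le> r})"
    by (intro closed_Int closed_cochains)
  then have cl: "closed ?S"
    by (simp add: Int_def)
  have "?S \<subseteq> B"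
  proof (clarsimp simp: B_def PiE_UNIV_domain)
    fix f :: "'a set \<Rightarrow> real" and \<sigma>
    assume f: "f \<in> cochains X i" "cochain_inner X i f f \<le> r"
    have "(f \<sigma>)\<^sup>2 \<le> r"
    proof (cases "\<sigma> \<in> faces X i")
      case True
      have "f \<sigma> * f \<sigma> \<le> cochain_inner X i f f"
        unfolding cochain_inner_def by (rule member_le_sum) (use True assms in auto)
      with f show ?thesis by (simp add: power2_eq_square)
    next
      case False
      with f have "f \<sigma> = 0" by (auto simp: cochains_def)
      moreover have "0 \<le> r"
        using f cochain_inner_nonneg[of X i f] by linarith
      ultimately show ?thesis by simp
    qed
    then have "\<bar>f \<sigma>\<bar> \<le> sqrt r"
      by (metis real_sqrt_abs real_sqrt_le_mono)
    then show "- sqrt r \<le> f \<sigma> \<and> f \<sigma> \<le> sqrt r" by linarith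
  qed
  with cl \<open>compact B\<close> have "compact (?S \<inter> B)"
    by (simp add: closed_Int_compact)
  with \<open>?S \<subseteq> B\<close> show ?thesis by (simp add: Int_absorb2)
qed

lemma closed_coboundaries_perp: "closed (coboundaries_perp X i)"
proof -
  have "closed (\<Inter>b\<in>coboundaries X i. {f. cochain_inner X i f b = 0})"
    by (intro closed_INT ballI closed_Collect_eq continuous_on_cochain_inner continuous_on_const continuous_on_id)
  then have "closed (cochains X i \<inter> (\<Inter>b\<in>coboundaries X i. {f. cochain_inner X i f b = 0}))"
    by (intro closed_Int closed_cochains)
  moreover have "cochains X i \<inter> (\<Inter>b\<in>coboundaries X i. {f. cochain_inner X i f b = 0})
      = coboundaries_perp X i"
    by (auto simp: coboundaries_perp_def)
  ultimately show ?thesis by simp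
qed

section \<open>The smallest eigenvalue by minimisation\<close>

lemma up_laplacian_in_perp:
  assumes X: "abstract_simplicial_complex V X"
  shows "up_laplacian X i f \<in> coboundaries_perp X i"
proof -
  have "cochain_inner X i (up_laplacian X i f) (coboundary X (i - 1) e) = 0"
    if "e \<in> cochains X (i - 1)" for e
  proof -
    have "coboundary X i (coboundary X (i - 1) e) = (\<lambda>_. 0)"
      using coboundary_coboundary[OF X that] by simp
    then show ?thesis
      by (subst cochain_inner_commute) (simp add: cochain_inner_up_laplacian[OF X])
  qed
  then show ?thesis
    using up_laplacian_cochain[OF X] by (auto simp: coboundaries_perp_def coboundaries_def)
qed

text \<open>A minimiser of the Rayleigh quotient on the orthogonal complement is an eigenvector, and
  every other eigenvalue there is itself a Rayleigh quotient. The nonzero \<open>g\<close>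
  guarantees that an eigenvalue exists, so that the \<open>LEAST\<close> in
  \<open>spectral_gap\<close> is attained.\<close>

lemma spectral_gap_rayleigh:
  fixes X :: "'a::linorder set set"
  assumes X: "abstract_simplicial_complex V X"
    and g: "g \<in> coboundaries_perp X (int k - 1)" "g \<noteq> (\<lambda>_. 0)"
  shows "spectral_gap X k \<ge> 0"
    and "\<And>f. f \<in> coboundaries_perp X (int k - 1) \<Longrightarrow>
      spectral_gap X k * cochain_inner X (int k - 1) f f
      \<le> cochain_inner X (int k) (coboundary X (int k - 1) f) (coboundary X (int k - 1) f)"
proof -
  define i where "i = int k - 1"
  define W where "W = coboundaries_perp X i"
  define ip where "ip = cochain_inner X i"
  define Q where "Q f g = cochain_inner X (i + 1) (coboundary X i f) (coboundary X i g)" for f g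
  have g: "g \<in> W" "g \<noteq> (\<lambda>_. 0)" using g by (simp_all add: W_def i_def)
  have fin: "finite (faces X i)" using X by (rule finite_faces)
  have pos: "ip f f > 0" if "f \<in> W" "f \<noteq> (\<lambda>_. 0)" for f
    using that cochain_inner_eq_0D[OF fin, of f] cochain_inner_nonneg[of X i f]
    by (auto simp: W_def ip_def coboundaries_perp_def less_le)
  have Q_scaled: "Q (\<lambda>\<sigma>. t * f \<sigma>) (\<lambda>\<sigma>. t * f \<sigma>) = t\<^sup>2 * Q f f" for t f
    by (simp add: Q_def coboundary_scaled cochain_inner_scaled power2_eq_square)
  have ip_scaled: "ip (\<lambda>\<sigma>. t * f \<sigma>) (\<lambda>\<sigma>. t * f \<sigma>) = t\<^sup>2 * ip f f" for t f
    by (simp add: ip_def cochain_inner_scaled power2_eq_square)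
  define S where "S = {f \<in> W. ip f f = 1}"
  have unit: "(\<lambda>\<sigma>. inverse (sqrt (ip f f)) * f \<sigma>) \<in> S" if "f \<in> W" "f \<noteq> (\<lambda>_. 0)" for f
    using pos[OF that] that
    by (simp add: S_def ip_scaled W_def coboundaries_perp_scaled power_inverse)
  have S_eq: "S = {f \<in> cochains X i. ip f f \<le> 1} \<inter> (W \<inter> {f. ip f f = 1})"
    by (auto simp: S_def W_def coboundaries_perp_def)
  have "closed (W \<inter> {f. ip f f = 1})"
    unfolding W_def ip_def
    by (intro closed_Int closed_coboundaries_perp closed_Collect_eq continuous_on_cochain_inner
        continuous_on_const continuous_on_id)
  then have "compact S"
    unfolding S_eq by (intro compact_Int_closed) (simp_all add: ip_def compact_cochain_ball fin)
  moreover have "S \<noteq> {}" using unit[OF g] by blast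
  moreover have "continuous_on S (\<lambda>f. Q f f)"
    unfolding Q_def by (intro continuous_on_cochain_inner continuous_on_coboundary)
  ultimately obtain h where h: "h \<in> S" "\<And>f. f \<in> S \<Longrightarrow> Q h h \<le> Q f f"
    using continuous_attains_inf[of S "\<lambda>f. Q f f"] by auto
  define c where "c = Q h h"
  have c0: "c \<ge> 0" by (simp add: c_def Q_def)
  have ray: "c * ip f f \<le> Q f f" if f: "f \<in> W" for f
  proof (cases "f = (\<lambda>_. 0)")
    case True
    then show ?thesis by (simp add: ip_def Q_def)
  next
    case False
    have "c \<le> inverse (ip f f) * Q f f"
      using h(2)[OF unit[OF f False]] pos[OF f False]
      by (simp add: c_def Q_scaled power_inverse)
    with pos[OF f False] show ?thesis by (simp add: field_simps)
  qed
  have hW: "h \<in> W" and h1: "ip h h = 1" using h by (auto simp: S_def)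
  \<comment> \<open>The form \<open>Q f f - c * ip f f\<close> is nonnegative on \<open>W\<close>
    and vanishes at \<open>h\<close>, so its first variation at \<open>h\<close> in the direction
    \<open>f\<close> is zero.\<close>
  have weak: "Q h f = c * ip h f" if f: "f \<in> W" for f
  proof -
    have "0 \<le> t * (2 * (Q h f - c * ip h f)) + t\<^sup>2 * (Q f f - c * ip f f)" for t
    proof -
      have "(\<lambda>\<sigma>. h \<sigma> + t * f \<sigma>) \<in> W"
        using hW f by (simp add: W_def coboundaries_perp_add_scaled)
      from ray[OF this] have "c * (ip h h + t * (2 * ip h f) + t\<^sup>2 * ip f f)
          \<le> Q h h + t * (2 * Q h f) + t\<^sup>2 * Q f f"
        by (simp add: ip_def Q_def coboundary_add_scaled cochain_inner_norm_add_scaled)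
      then show ?thesis
        by (simp add: h1 c_def algebra_simps)
    qed
    then have "2 * (Q h f - c * ip h f) = 0"
      by (rule quadratic_nonneg_linear_coeff_0)
    then show ?thesis by simp
  qed
  \<comment> \<open>The residual of the eigenvalue equation lies in \<open>W\<close>, since the
    up-Laplacian maps into \<open>W\<close>. Testing \<open>weak\<close> against the residual itself
    shows that its norm is zero.\<close>
  define r where "r = (\<lambda>\<sigma>. up_laplacian X i h \<sigma> + (- c) * h \<sigma>)"
  have rW: "r \<in> W"
    using hW unfolding r_def W_def
    by (intro coboundaries_perp_add_scaled up_laplacian_in_perp[OF X])
  have "ip r r = ip r (up_laplacian X i h) + (- c) * ip r h"
    unfolding ip_def
    using cochain_inner_add_scaled(2)[of X i r "up_laplacian X i h" "- c" h, folded r_def] .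
  also have "\<dots> = Q r h - c * ip r h"
    by (simp add: ip_def Q_def cochain_inner_up_laplacian[OF X])
  also have "\<dots> = 0"
    using weak[OF rW] by (simp add: ip_def Q_def cochain_inner_commute)
  finally have "r = (\<lambda>_. 0)" using pos[OF rW] by force
  then have "up_laplacian X i h = (\<lambda>\<sigma>. c * h \<sigma>)"
    by (auto simp: r_def fun_eq_iff)
  moreover have "h \<noteq> (\<lambda>_. 0)" using h1 by (auto simp: ip_def)
  ultimately have "perp_eigenvalue X i c"
    using hW by (auto simp: perp_eigenvalue_def W_def)
  moreover have "c \<le> c'" if c': "perp_eigenvalue X i c'" for c'
  proof -
    obtain f where f: "f \<in> W" "f \<noteq> (\<lambda>_. 0)" "up_laplacian X i f = (\<lambda>\<sigma>. c' * f \<sigma>)"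
      using c' by (auto simp: perp_eigenvalue_def W_def)
    have "Q f f = c' * ip f f"
      unfolding Q_def ip_def cochain_inner_up_laplacian[OF X, symmetric] f(3)
      by (simp add: cochain_inner_scaled)
    with ray[OF f(1)] pos[OF f(1,2)] show ?thesis by simp
  qed
  ultimately have "spectral_gap X k = c"
    unfolding spectral_gap_def i_def by (intro Least_equality)
  with c0 ray show "spectral_gap X k \<ge> 0"
    and "\<And>f. f \<in> coboundaries_perp X (int k - 1) \<Longrightarrow>
      spectral_gap X k * cochain_inner X (int k - 1) f f
      \<le> cochain_inner X (int k) (coboundary X (int k - 1) f) (coboundary X (int k - 1) f)"
    by (simp_all add: W_def ip_def Q_def i_def)
qed

section \<open>Norm-minimal cochains with prescribed coboundary\<close>

lemma full_coboundary_add_scaled: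
  "full_coboundary (\<lambda>\<sigma>. f \<sigma> + t * g \<sigma>) \<tau> = full_coboundary f \<tau> + t * full_coboundary g \<tau>"
  by (simp add: full_coboundary_def algebra_simps sum.distrib sum_distrib_left)

text \<open>Adding a cochain \<open>e\<close> whose full coboundary vanishes on \<open>T\<close>
  keeps the constraint, so the minimiser \<open>h\<close> must be orthogonal to
  \<open>e\<close>.\<close>

lemma minimal_norm_cochain:
  fixes g :: "'a::linorder set \<Rightarrow> real"
  assumes fin: "finite (faces X i)" and g: "g \<in> cochains X i"
  obtains h where "h \<in> cochains X i" "\<And>\<tau>. \<tau> \<in> T \<Longrightarrow> full_coboundary h \<tau> = full_coboundary g \<tau>"
    "\<And>e. e \<in> cochains X i \<Longrightarrow> (\<And>\<tau>. \<tau> \<in> T \<Longrightarrow> full_coboundary e \<tau> = 0)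
      \<Longrightarrow> cochain_inner X i h e = 0"
proof -
  define Z where "Z = (\<Inter>\<tau>\<in>T. {h. full_coboundary h \<tau> = full_coboundary g \<tau>})"
  \<comment> \<open>Cutting down to the ball through \<open>g\<close> gives compactness; a
    competitor outside it is longer than \<open>g\<close> and hence than \<open>h\<close>.\<close>
  define S where "S = {f \<in> cochains X i. cochain_inner X i f f \<le> cochain_inner X i g g} \<inter> Z"
  have "closed {h. full_coboundary h \<tau> = full_coboundary g \<tau>}" for \<tau>
    unfolding full_coboundary_def
    by (intro closed_Collect_eq continuous_on_sum continuous_on_mult continuous_on_const
        continuous_on_product_coordinates)
  then have "closed Z" unfolding Z_def by blast
  then have "compact S"
    unfolding S_def by (intro compact_Int_closed compact_cochain_ball fin)
  moreover have "g \<in> S" using g by (auto simp: S_def Z_def)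
  moreover have "continuous_on S (\<lambda>f. cochain_inner X i f f)"
    by (intro continuous_on_cochain_inner continuous_on_id)
  ultimately obtain h where h: "h \<in> S" "\<And>f. f \<in> S \<Longrightarrow> cochain_inner X i h h \<le> cochain_inner X i f f"
    using continuous_attains_inf[of S "\<lambda>f. cochain_inner X i f f"] by auto
  have min: "cochain_inner X i h h \<le> cochain_inner X i f f" if "f \<in> cochains X i" "f \<in> Z" for f
  proof (cases "f \<in> S")
    case True
    then show ?thesis by (rule h)
  next
    case False
    with that h(1) show ?thesis by (auto simp: S_def)
  qed
  show ?thesis
  proof
    show "h \<in> cochains X i" "\<And>\<tau>. \<tau> \<in> T \<Longrightarrow> full_coboundary h \<tau> = full_coboundary g \<tau>"
      using h(1) by (auto simp: S_def Z_def)
  next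
    fix e assume e: "e \<in> cochains X i" "\<And>\<tau>. \<tau> \<in> T \<Longrightarrow> full_coboundary e \<tau> = 0"
    have "0 \<le> t * (2 * cochain_inner X i h e) + t\<^sup>2 * cochain_inner X i e e" for t
    proof -
      have "(\<lambda>\<sigma>. h \<sigma> + t * e \<sigma>) \<in> cochains X i" "(\<lambda>\<sigma>. h \<sigma> + t * e \<sigma>) \<in> Z"
        using h(1) e by (auto simp: S_def Z_def full_coboundary_add_scaled cochains_add_scaled)
      from min[OF this] show ?thesis by (simp add: cochain_inner_norm_add_scaled)
    qed
    then have "2 * cochain_inner X i h e = 0"
      by (rule quadratic_nonneg_linear_coeff_0)
    then show "cochain_inner X i h e = 0" by simp
  qed
qed

subsection \<open>Orienting transversal faces\<close>

text \<open>When \<open>p\<close> is injective on \<open>\<sigma>\<close>, this is the sign of the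
  permutation that rearranges \<open>\<sigma>\<close> from the vertex order into the order of the
  parts.\<close>

definition inversion_sign :: "('a::linorder \<Rightarrow> nat) \<Rightarrow> 'a set \<Rightarrow> real" where
  "inversion_sign p \<sigma> = (-1) ^ card {(u, w). u \<in> \<sigma> \<and> w \<in> \<sigma> \<and> u < w \<and> p w < p u}"

lemma inversion_sign_square [simp]: "inversion_sign p \<sigma> * inversion_sign p \<sigma> = 1"
  by (simp add: inversion_sign_def flip: power_mult_distrib)

text \<open>The new inversions are those in \<open>A\<close> and \<open>B\<close>. The two extra
  sign factors count \<open>A\<close> with \<open>C\<close> and \<open>B\<close> with
  \<open>C\<close>, so \<open>C\<close> cancels. The last factor depends on \<open>v\<close> only
  through \<open>p v\<close>.\<close>

lemma inversion_sign_insert: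
  assumes \<rho>: "finite \<rho>" "v \<notin> \<rho>" and p: "\<And>u. u \<in> \<rho> \<Longrightarrow> p u \<noteq> p v"
  shows "inversion_sign p (insert v \<rho>)
    = inversion_sign p \<rho> * vsign v \<rho> * (-1) ^ card {u \<in> \<rho>. p u < p v}"
proof -
  define S where "S = {(u, w). u \<in> \<rho> \<and> w \<in> \<rho> \<and> u < w \<and> p w < p u}"
  define A where "A = {u \<in> \<rho>. u < v \<and> p v < p u}"
  define B where "B = {u \<in> \<rho>. v < u \<and> p u < p v}"
  define C where "C = {u \<in> \<rho>. u < v \<and> p u < p v}"
  have fin: "finite A" "finite B" "finite C"
    using \<rho> by (auto simp: A_def B_def C_def)
  have "S \<subseteq> \<rho> \<times> \<rho>" by (auto simp: S_def)
  then have finS: "finite S"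
    using \<rho> by (auto intro: finite_subset)
  have "{(u, w). u \<in> insert v \<rho> \<and> w \<in> insert v \<rho> \<and> u < w \<and> p w < p u}
      = S \<union> ((\<lambda>u. (u, v)) ` A \<union> Pair v ` B)"
    by (auto simp: S_def A_def B_def)
  moreover have "card (S \<union> ((\<lambda>u. (u, v)) ` A \<union> Pair v ` B))
      = card S + card ((\<lambda>u. (u, v)) ` A \<union> Pair v ` B)"
    using \<rho> by (intro card_Un_disjoint finS finite_UnI finite_imageI fin) (auto simp: S_def)
  moreover have "card ((\<lambda>u. (u, v)) ` A \<union> Pair v ` B)
      = card ((\<lambda>u. (u, v)) ` A) + card (Pair v ` B)"
    using \<rho> by (intro card_Un_disjoint finite_imageI fin) (auto simp: A_def)
  moreover have "card ((\<lambda>u. (u, v)) ` A) = card A" "card (Pair v ` B) = card B"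
    by (auto intro!: card_image simp: inj_on_def)
  ultimately have 1: "card {(u, w). u \<in> insert v \<rho> \<and> w \<in> insert v \<rho> \<and> u < w \<and> p w < p u}
      = card S + (card A + card B)"
    by simp
  have "{u \<in> \<rho>. u < v} = A \<union> C"
    using p by (force simp: A_def C_def)
  moreover have "card (A \<union> C) = card A + card C"
    by (intro card_Un_disjoint fin) (auto simp: A_def C_def)
  ultimately have 2: "card {u \<in> \<rho>. u < v} = card A + card C" by simp
  have "{u \<in> \<rho>. p u < p v} = B \<union> C"
    using \<rho> by (auto simp: B_def C_def) (metis linorder_less_linear)
  moreover have "card (B \<union> C) = card B + card C"
    by (intro card_Un_disjoint fin) (auto simp: B_def C_def)
  ultimately have 3: "card {u \<in> \<rho>. p u < p v} = card B + card C" by simp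
  have "(-1 :: real) ^ card C * (-1) ^ card C = 1"
    by (simp flip: power_mult_distrib)
  then show ?thesis
    unfolding inversion_sign_def vsign_def 1 2 3 S_def[symmetric]
    by (simp add: power_add)
qed

text \<open>If \<open>p\<close> is constant on exactly one pair \<open>v \<noteq> v'\<close> of vertices of \<open>\<tau>\<close>, only the two facets
  avoiding one of them can be transversal, and their induced orientations cancel; so the real
  coboundary is \<open>\<plusminus>(x - y)\<close>, with \<open>x\<close> and \<open>y\<close> the values of \<open>f\<close> as \<open>0/1\<close> reals.\<close>

lemma full_coboundary_oriented:
  fixes f :: "'a::linorder set \<Rightarrow> bit" and p :: "'a \<Rightarrow> nat"
  defines "g \<equiv> \<lambda>\<sigma>. if f \<sigma> = 0 then 0 else inversion_sign p \<sigma>"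
  assumes \<tau>: "finite \<tau>" "p ` \<tau> \<subseteq> P" and f: "\<And>\<sigma>. f \<sigma> \<noteq> 0 \<Longrightarrow> bij_betw p \<sigma> P"
  shows "(full_coboundary g \<tau>)\<^sup>2 = (if (\<Sum>v\<in>\<tau>. f (\<tau> - {v})) = 0 then 0 else 1)"
proof (cases "\<exists>v\<in>\<tau>. f (\<tau> - {v}) \<noteq> 0")
  case False
  then show ?thesis by (simp add: full_coboundary_def g_def)
next
  case True
  then obtain v' where v': "v' \<in> \<tau>" "f (\<tau> - {v'}) \<noteq> 0" by blast
  have bij: "bij_betw p (\<tau> - {v'}) P" using v'(2) by (rule f)
  \<comment> \<open>The facet without \<open>v'\<close> already meets every class, so it contains a
    vertex \<open>v\<close> of the same class as \<open>v'\<close>.\<close>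
  have "p v' \<in> p ` (\<tau> - {v'})"
    unfolding bij_betw_imp_surj_on[OF bij] using \<tau>(2) v'(1) by blast
  then obtain v where v: "v \<in> \<tau>" "v \<noteq> v'" "p v = p v'" by force
  define \<rho> where "\<rho> = \<tau> - {v, v'}"
  have \<rho>: "finite \<rho>" "v \<notin> \<rho>" "v' \<notin> \<rho>" and \<tau>_eq: "\<tau> = insert v (insert v' \<rho>)"
    using \<tau> v v' by (auto simp: \<rho>_def)
  have facets: "\<tau> - {v} = insert v' \<rho>" "\<tau> - {v'} = insert v \<rho>"
    using \<rho> v by (auto simp: \<tau>_eq)
  have p: "p u \<noteq> p v" if "u \<in> \<rho>" for u
    using bij that \<rho> v unfolding bij_betw_def facets inj_on_def by blast
  \<comment> \<open>Any other facet contains both \<open>v\<close> and \<open>v'\<close>, so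
    \<open>p\<close> is not injective on it.\<close>
  have f0: "f (\<tau> - {w}) = 0" if "w \<in> \<tau> - {v, v'}" for w
  proof (rule ccontr)
    assume "f (\<tau> - {w}) \<noteq> 0"
    then have "inj_on p (\<tau> - {w})" using f by (auto simp: bij_betw_def)
    then show False using that v v' by (auto simp: inj_on_def)
  qed
  have two: "sum F \<tau> = F v + F v'" if "\<And>w. w \<in> \<tau> - {v, v'} \<Longrightarrow> F w = 0"
    for F :: "'a \<Rightarrow> 'b::comm_monoid_add"
  proof -
    have "sum F \<tau> = sum F {v, v'}"
      by (rule sum.mono_neutral_right) (use \<tau> v v' that in auto)
    with v show ?thesis by simp
  qed
  \<comment> \<open>Since \<open>p v = p v'\<close>, this factor is common to the orientations of
    both remaining facets.\<close>
  define e where "e = inversion_sign p \<rho> * (-1) ^ card {u \<in> \<rho>. p u < p v}"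
  define x where "x = (if f (insert v' \<rho>) = 0 then 0 else 1 :: real)"
  define y where "y = (if f (insert v \<rho>) = 0 then 0 else 1 :: real)"
  have g: "g (insert v' \<rho>) = e * vsign v' \<rho> * x" "g (insert v \<rho>) = e * vsign v \<rho> * y"
    using inversion_sign_insert[of \<rho> v p] inversion_sign_insert[of \<rho> v' p] \<rho> p v
    by (simp_all add: g_def e_def x_def y_def)
  have e2: "e * e = 1"
    by (simp add: e_def algebra_simps flip: power_mult_distrib)
  \<comment> \<open>This is the relative sign of the two terms; being \<open>- 1\<close>, it makes
    the cross term of the square \<open>- 2 * x * y\<close>.\<close>
  have s: "vsign v \<tau> * vsign v' \<tau> * (vsign v \<rho> * vsign v' \<rho>) = - 1"
  proof -
    have "vsign v \<tau> * vsign v' \<tau> = - (vsign v \<rho> * vsign v' \<rho>)"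
      unfolding \<tau>_eq using \<rho> v by (intro vsign_insert_mult)
    moreover have "(vsign v \<rho> * vsign v' \<rho>) * (vsign v \<rho> * vsign v' \<rho>) = 1"
      using vsign_mult_square[of v \<rho> "vsign v' \<rho>"] by (simp add: power2_eq_square)
    ultimately show ?thesis by simp
  qed
  have "full_coboundary g \<tau> = vsign v \<tau> * g (insert v' \<rho>) + vsign v' \<tau> * g (insert v \<rho>)"
    unfolding full_coboundary_def by (subst two) (use f0 in \<open>simp_all add: g_def facets\<close>)
  also have "\<dots> = e * (vsign v \<tau> * vsign v' \<rho> * x + vsign v' \<tau> * vsign v \<rho> * y)"
    by (simp add: g algebra_simps)
  finally have "(full_coboundary g \<tau>)\<^sup>2
      = (e * e) * ((vsign v \<tau> * vsign v \<tau>) * (vsign v' \<rho> * vsign v' \<rho>) * x\<^sup>2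
        + (vsign v' \<tau> * vsign v' \<tau>) * (vsign v \<rho> * vsign v \<rho>) * y\<^sup>2
        + 2 * (vsign v \<tau> * vsign v' \<tau> * (vsign v \<rho> * vsign v' \<rho>)) * (x * y))"
    by algebra
  also have "\<dots> = (x - y)\<^sup>2"
    unfolding e2 s vsign_square by (simp add: power2_eq_square algebra_simps)
  also have "\<dots> = (if f (insert v' \<rho>) + f (insert v \<rho>) = 0 then 0 else 1)"
    by (auto simp: x_def y_def)
  also have "f (insert v' \<rho>) + f (insert v \<rho>) = (\<Sum>v\<in>\<tau>. f (\<tau> - {v}))"
    using f0 by (subst two) (auto simp: facets)
  finally show ?thesis .
qed

lemma coboundary2_eq_sum_facets:
  assumes fin: "finite (faces X i)" "finite \<tau>" and f: "f \<in> cochains X i" and \<tau>: "\<tau> \<in> faces X (i + 1)"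
  shows "coboundary2 X i f \<tau> = (\<Sum>v\<in>\<tau>. f (\<tau> - {v}))"
proof -
  define F where "F = (\<lambda>\<sigma>. if \<sigma> \<subset> \<tau> then f \<sigma> else 0)"
  have facet: "\<exists>v\<in>\<tau>. \<sigma> = \<tau> - {v}" if "\<sigma> \<in> faces X i" "\<sigma> \<subset> \<tau>" for \<sigma>
  proof -
    have "card (\<tau> - \<sigma>) = 1"
      using that \<tau> fin by (subst card_Diff_subset) (auto simp: faces_def finite_subset)
    then obtain v where "\<tau> - \<sigma> = {v}" by (auto simp: card_1_singleton_iff)
    with that show ?thesis by blast
  qed
  have "(\<Sum>\<sigma> | \<sigma> \<in> faces X i \<and> \<sigma> \<subset> \<tau>. f \<sigma>) = sum F (faces X i)"
    by (rule sum.mono_neutral_cong_left) (use fin in \<open>auto simp: F_def\<close>)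
  also have "\<dots> = (\<Sum>v\<in>\<tau>. F (\<tau> - {v}))"
    by (rule sum_facets) (use fin f facet in \<open>auto simp: F_def cochains_def\<close>)
  also have "\<dots> = (\<Sum>v\<in>\<tau>. f (\<tau> - {v}))"
    by (rule sum.cong) (auto simp: F_def)
  finally show ?thesis
    using \<tau> by (simp add: coboundary2_def)
qed

text \<open>Each squared value of the lifted coboundary is the indicator of the support. The complex
  is arbitrary, so one lift serves for both \<open>X\<close> and its completion.\<close>

lemma hamming_weight_coboundary2:
  fixes f :: "'a::linorder set \<Rightarrow> bit" and p :: "'a \<Rightarrow> nat"
  assumes X: "abstract_simplicial_complex V X" and f: "f \<in> cochains X i"
    and p: "p ` V \<subseteq> P" "\<And>\<sigma>. f \<sigma> \<noteq> 0 \<Longrightarrow> bij_betw p \<sigma> P"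
  shows "real (hamming_weight (coboundary2 X i f)) = (\<Sum>\<tau>\<in>faces X (i + 1).
      (full_coboundary (\<lambda>\<sigma>. if f \<sigma> = 0 then 0 else inversion_sign p \<sigma>) \<tau>)\<^sup>2)"
proof -
  have "(full_coboundary (\<lambda>\<sigma>. if f \<sigma> = 0 then 0 else inversion_sign p \<sigma>) \<tau>)\<^sup>2
      = (if coboundary2 X i f \<tau> = 0 then 0 else 1)" if \<tau>: "\<tau> \<in> faces X (i + 1)" for \<tau>
  proof -
    have "\<tau> \<subseteq> V" using X \<tau> by (auto simp: abstract_simplicial_complex_def faces_def)
    then have "p ` \<tau> \<subseteq> P" using p by blast
    then show ?thesis
      using coboundary2_eq_sum_facets[OF finite_faces[OF X] finite_face[OF X \<tau>] f \<tau>]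
        full_coboundary_oriented[OF finite_face[OF X \<tau>] _ p(2)]
      by simp
  qed
  then have "(\<Sum>\<tau>\<in>faces X (i + 1).
      (full_coboundary (\<lambda>\<sigma>. if f \<sigma> = 0 then 0 else inversion_sign p \<sigma>) \<tau>)\<^sup>2)
      = (\<Sum>\<tau>\<in>faces X (i + 1). if coboundary2 X i f \<tau> = 0 then 0 else 1)"
    by (rule sum.cong[OF refl])
  also have "\<dots> = (\<Sum>\<tau>\<in>support (coboundary2 X i f). 1)"
    by (rule sum.mono_neutral_cong_right)
      (use finite_faces[OF X] in \<open>auto simp: support_def coboundary2_def split: if_splits\<close>)
  also have "\<dots> = real (hamming_weight (coboundary2 X i f))"
    by (simp add: hamming_weight_def)
  finally show ?thesis ..
qed

subsection \<open>The completion and the inequality\<close>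

lemma abstract_simplicial_complex_completion:
  assumes X: "abstract_simplicial_complex V X"
  shows "abstract_simplicial_complex V (completion V k X)"
proof -
  have "\<sigma> \<in> completion V k X" if "\<tau> \<in> completion V k X" "\<sigma> \<subseteq> \<tau>" for \<sigma> \<tau>
  proof (cases "\<tau> \<in> X \<or> \<sigma> = \<tau>")
    case True
    then show ?thesis
      using that X by (auto simp: completion_def abstract_simplicial_complex_def)
  next
    case False
    with that obtain v where "v \<in> \<tau>" "\<sigma> \<subseteq> \<tau> - {v}" "\<tau> - {v} \<in> X"
      by (auto simp: completion_def)
    then show ?thesis
      using X by (auto simp: completion_def abstract_simplicial_complex_def)
  qed
  then show ?thesis
    using X by (auto simp: completion_def abstract_simplicial_complex_def)
qed

lemma faces_completion: "faces (completion V k X) (int k - 1) = faces X (int k - 1)"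
  by (auto simp: faces_def completion_def)

lemma bij_betw_partition_index:
  assumes A: "is_partition V k A" and \<sigma>: "\<sigma> \<subseteq> V" "\<And>i. i < k \<Longrightarrow> card (\<sigma> \<inter> A i) = 1"
    and p: "\<And>u. u \<in> V \<Longrightarrow> p u < k \<and> u \<in> A (p u)"
  shows "bij_betw p \<sigma> {..<k}"
  unfolding bij_betw_def
proof
  show "inj_on p \<sigma>"
  proof (rule inj_onI)
    fix u w assume u: "u \<in> \<sigma>" "w \<in> \<sigma>" "p u = p w"
    then have "u \<in> \<sigma> \<inter> A (p u)" "w \<in> \<sigma> \<inter> A (p u)" "p u < k"
      using p[of u] p[of w] \<sigma> by auto
    with \<sigma>(2)[of "p u"] show "u = w" by (metis card_1_singletonE singletonD)
  qed
  show "p ` \<sigma> = {..<k}"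
  proof
    show "p ` \<sigma> \<subseteq> {..<k}" using p \<sigma> by auto
    show "{..<k} \<subseteq> p ` \<sigma>"
    proof
      fix i assume i: "i \<in> {..<k}"
      then obtain u where u: "u \<in> \<sigma>" "u \<in> A i"
        using \<sigma>(2)[of i] by (auto simp: card_1_singleton_iff)
      then have "p u < k" "u \<in> A (p u)" using p[of u] \<sigma> by auto
      then have "p u = i"
        using A u i unfolding is_partition_def disjoint_family_on_def by blast
      with u show "i \<in> p ` \<sigma>" by blast
    qed
  qed
qed

lemma spectral_gap_le_cheeger_quotient:
  fixes V :: "'a::linorder set"
  assumes X: "abstract_simplicial_complex V X" and f: "f \<in> cheeger_test_cochains V k X"
  shows "ereal (spectral_gap X k) \<le> cheeger_quotient V k X f"
proof -
  define i where "i = int k - 1"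
  define K where "K = completion V k X"
  have K: "abstract_simplicial_complex V K"
    unfolding K_def using X by (rule abstract_simplicial_complex_completion)
  have faces_K: "faces K i = faces X i"
    by (simp add: K_def i_def faces_completion)
  have faces_sub: "faces X (i + 1) \<subseteq> faces K (i + 1)"
    by (auto simp: K_def completion_def faces_def)
  obtain A where f: "f \<in> cochains X i" and A: "is_partition V k A"
    and supp: "support f \<subseteq> transversal_faces X k A"
    using f by (auto simp: cheeger_test_cochains_def i_def)
  have "\<exists>j. j < k \<and> u \<in> A j" if "u \<in> V" for u
    using A that by (auto simp: is_partition_def)
  then obtain p where p: "\<And>u. u \<in> V \<Longrightarrow> p u < k \<and> u \<in> A (p u)"
    by metis
  have bij: "bij_betw p \<sigma> {..<k}" if "f \<sigma> \<noteq> 0" for \<sigma>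
  proof (rule bij_betw_partition_index[OF A _ _ p])
    have "\<sigma> \<in> transversal_faces X k A" using that supp by (auto simp: support_def)
    then show "\<sigma> \<subseteq> V" "\<And>j. j < k \<Longrightarrow> card (\<sigma> \<inter> A j) = 1"
      using X by (auto simp: transversal_faces_def faces_def abstract_simplicial_complex_def)
  qed
  have pV: "p ` V \<subseteq> {..<k}" using p by auto
  define g where "g = (\<lambda>\<sigma>. if f \<sigma> = 0 then 0 else inversion_sign p \<sigma>)"
  define d where "d = real (hamming_weight (coboundary2 X i f))"
  define d' where "d' = real (hamming_weight (coboundary2 K i f))"
  have d: "d = (\<Sum>\<tau>\<in>faces X (i + 1). (full_coboundary g \<tau>)\<^sup>2)"
    unfolding d_def g_def by (rule hamming_weight_coboundary2[OF X f pV bij])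
  have "f \<in> cochains K i" using f by (simp add: cochains_def faces_K)
  then have d': "d' = (\<Sum>\<tau>\<in>faces K (i + 1). (full_coboundary g \<tau>)\<^sup>2)"
    unfolding d'_def g_def by (intro hamming_weight_coboundary2[OF K _ pV bij])
  have "g \<in> cochains X i" using f by (auto simp: g_def cochains_def)
  \<comment> \<open>The constraint is imposed on the top faces of \<open>K\<close>, which include
    those of \<open>X\<close>; passing from \<open>g\<close> to \<open>h\<close> therefore preserves
    both \<open>d\<close> and \<open>d'\<close>.\<close>
  then obtain h where h: "h \<in> cochains X i"
      and hg: "\<And>\<tau>. \<tau> \<in> faces K (i + 1) \<Longrightarrow> full_coboundary h \<tau> = full_coboundary g \<tau>"
      and orth: "\<And>e. e \<in> cochains X i \<Longrightarrow> (\<And>\<tau>. \<tau> \<in> faces K (i + 1) \<Longrightarrow> full_coboundary e \<tau> = 0)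
        \<Longrightarrow> cochain_inner X i h e = 0"
    using minimal_norm_cochain[OF finite_faces[OF X], of g i "faces K (i + 1)"] by blast
  \<comment> \<open>Facets of a top face of \<open>K\<close> are faces of \<open>X\<close>, so
    coboundaries in \<open>X\<close> have zero full coboundary on \<open>K\<close> and are
    admissible in \<open>orth\<close>.\<close>
  have perp: "h \<in> coboundaries_perp X i"
  proof -
    have "cochain_inner X i h (coboundary X (i - 1) e) = 0" if e: "e \<in> cochains X (i - 1)" for e
    proof (rule orth)
      show "coboundary X (i - 1) e \<in> cochains X i"
        using coboundary_cochain[of X "i - 1" e] by simp
      fix \<tau> assume "\<tau> \<in> faces K (i + 1)"
      then show "full_coboundary (coboundary X (i - 1) e) \<tau> = 0"
        using face_remove[OF K, of \<tau> i] finite_face[OF K, of \<tau>]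
        by (intro full_coboundary_coboundary[OF X e]) (auto simp: faces_K)
    qed
    with h show ?thesis by (auto simp: coboundaries_perp_def coboundaries_def)
  qed
  define N where "N = cochain_inner X i h h"
  have V: "finite V" and sub: "\<And>j. faces X j \<subseteq> Pow V" "\<And>j. faces K j \<subseteq> Pow V"
    using X K by (auto simp: abstract_simplicial_complex_def faces_def)
  have "d' = (\<Sum>\<tau>\<in>faces K (i + 1). (full_coboundary h \<tau>)\<^sup>2)"
    unfolding d' by (rule sum.cong) (simp_all add: hg)
  also have "\<dots> \<le> (\<Sum>\<tau>\<in>Pow V. (full_coboundary h \<tau>)\<^sup>2)"
    by (rule sum_mono2) (use V sub in auto)
  also have "\<dots> \<le> card V * (\<Sum>\<sigma>\<in>Pow V. (h \<sigma>)\<^sup>2)"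
    using V by (rule full_coboundary_norm_le)
  also have "(\<Sum>\<sigma>\<in>Pow V. (h \<sigma>)\<^sup>2) = N"
    unfolding N_def cochain_inner_def
    by (rule sum.mono_neutral_cong_right)
      (use V sub h in \<open>auto simp: power2_eq_square cochains_def\<close>)
  finally have d'_le: "d' \<le> card V * N" .
  have d_eq: "d = cochain_inner X (i + 1) (coboundary X i h) (coboundary X i h)"
    unfolding d cochain_inner_def
  proof (rule sum.cong)
    fix \<tau> assume \<tau>: "\<tau> \<in> faces X (i + 1)"
    then have "coboundary X i h \<tau> = full_coboundary g \<tau>"
      using coboundary_eq_full[OF finite_faces[OF X] h \<tau> finite_face[OF X \<tau>]] hg faces_sub
      by auto
    then show "(full_coboundary g \<tau>)\<^sup>2 = coboundary X i h \<tau> * coboundary X i h \<tau>"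
      by (simp add: power2_eq_square)
  qed simp
  \<comment> \<open>For \<open>d' = 0\<close> the quotient is infinite. For \<open>d' > 0\<close>
    the bound \<open>d'_le\<close> forces \<open>h\<close> to be nonzero, as the Rayleigh lemma
    requires; its nonnegativity part lets \<open>d'_le\<close> be multiplied by the gap.\<close>
  have "ereal (spectral_gap X k) \<le> ereal (card V * d / d')" if d'0: "d' > 0"
  proof -
    have "h \<noteq> (\<lambda>_. 0)"
      using d'0 d'_le by (auto simp: N_def)
    then have gap: "spectral_gap X k \<ge> 0" "spectral_gap X k * N \<le> d"
      using spectral_gap_rayleigh[OF X, of h k] perp unfolding d_eq N_def
      by (simp_all add: i_def)
    have "spectral_gap X k * d' \<le> spectral_gap X k * (card V * N)"
      using d'_le gap(1) by (rule mult_left_mono)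
    also have "\<dots> = card V * (spectral_gap X k * N)" by simp
    also have "\<dots> \<le> card V * d"
      using gap(2) by (rule mult_left_mono) simp
    finally show ?thesis using d'0 by (simp add: field_simps)
  qed
  then show ?thesis
    by (auto simp: cheeger_quotient_def Let_def d_def d'_def K_def i_def)
qed

theorem theorem3:
  fixes V :: "'a::linorder set" and X :: "'a set set" and k :: nat
  assumes "k \<ge> 1"
    and "abstract_simplicial_complex V X"
    and "has_dimension X (int k)"
  shows "ereal (spectral_gap X k) \<le> cheeger' V k X"
proof -
  have "finite (cheeger_quotient V k X ` cheeger_test_cochains V k X)"
    using assms(2) by (intro finite_imageI finite_cheeger_test_cochains)
  moreover have "cheeger_quotient V k X ` cheeger_test_cochains V k X \<noteq> {}"
    using cheeger_test_cochains_nonempty[OF assms(1), of V X] by blast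
  ultimately show ?thesis
    unfolding cheeger'_def
    using spectral_gap_le_cheeger_quotient[OF assms(2)] by (intro Min.boundedI) blast+
qed

end
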